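(* Let $s,k\geq 1$ be integers, let $G_s=K_s+K_{s+1,1}$, let $n_s=|V(G_s)|=2(s+1)$, and let $x\in V(G_s)$ be a vertex of degree $d_{G_s}(x)=n_s/2$. Then the vertices that are good in $G_s$ remain good in the splice $k\cdot G_s x$ of $k$ copies of $G_s$ at $x$. Moreover, the proportion $\beta_{s,k}$ of good vertices in $k\cdot G_s x$ (the number of good vertices divided by the number of vertices) is $$\beta_{s,k}=\frac{k(s+1)}{k(2s+1)+1}.$$
   Context: All graphs are finite, simple, undirected and connected, except that for the join below the graphs being joined need not be connected. For vertices $a,b$ of a connected graph $G$, the resistance distance $\Omega_G(a,b)$ is the effective resistance between $a$ and $b$ in the electrical network obtained from $G$ by replacing each edge by a unit resistor; equivalently $\Omega_G(a,b)=(e_a-e_b)^{T}L^{\dagger}(e_a-e_b)$, where $L$ is the Laplacian matrix of $G$, $L^{\dagger}$ its Moore–Penrose inverse, and $e_a$ the standard unit vector indexed by $a$. The Kirchhoff index of a connected graph $G$ is $Kf(G)=\sum_{\{u,w\}\subseteq V(G)}\Omega_G(u,w)$, the sum over unordered pairs of distinct vertices. $G-v$ denotes the graph obtained from $G$ by deleting the vertex $v$ and its incident edges. A vertex $v$ of $G$ is good if $G-v$ is connected and $Kf(G)=Kf(G-v)$ (cut vertices are not good). $K_s$ is the complete graph on $s$ vertices and $K_{m,l}$ the complete bipartite graph with blocks of sizes $m$ and $l$. The join $H_1+H_2$ of two graphs is obtained from their disjoint union by adding all edges between $V(H_1)$ and $V(H_2)$. Thus $G_s=K_s+K_{s+1,1}$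 is isomorphic to the graph obtained from $K_{2s+2}$ by deleting all edges of an induced subgraph $K_{s+1}$; it has $s+1$ vertices of degree $s+1$ and $s+1$ vertices of degree $2s+1$. For a graph $H$ and $x\in V(H)$, the splice $k\cdot Hx$ is the graph obtained from $k$ disjoint copies $H_1,\dots,H_k$ of $H$ by identifying the $k$ vertices $x_i\in V(H_i)$ corresponding to $x$ into a single vertex, again called $x$ (for $k=1$ it is $H$ itself). "Vertices good in $G_s$ remain good" means that for each good vertex of $G_s$, each of its $k$ copies is a good vertex of $k\cdot G_s x$. *)

theory Defs
  imports Complex_Main "Graph_Theory.Graph_Theory"
begin

text \<open>
  A finite simple undirected graph is represented by the locale \<open>graph\<close> of \<open>Graph_Theory\<close>:
  a finite loop-free symmetric digraph without parallel arcs. Each undirected edge is thus a pair of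
  opposite arcs, and the degree of a vertex is its \<open>out_degree\<close>. Matrices indexed by a finite
  vertex set \<open>V\<close> are functions \<open>'a \<Rightarrow> 'a \<Rightarrow> real\<close> of which only the entries in
  \<open>V \<times> V\<close> matter.
\<close>

definition mat_mult_on ::
    "'a set \<Rightarrow> ('a \<Rightarrow> 'a \<Rightarrow> real) \<Rightarrow> ('a \<Rightarrow> 'a \<Rightarrow> real) \<Rightarrow> 'a \<Rightarrow> 'a \<Rightarrow> real" where
  "mat_mult_on V A B = (\<lambda>i j. \<Sum>k\<in>V. A i k * B k j)"

text \<open>The four Penrose conditions; the first conjunct fixes the irrelevant entries, so that
  the inverse is unique as a function.\<close>

definition is_moore_penrose_on ::
    "'a set \<Rightarrow> ('a \<Rightarrow> 'a \<Rightarrow> real) \<Rightarrow> ('a \<Rightarrow> 'a \<Rightarrow> real) \<Rightarrow> bool" where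
  "is_moore_penrose_on V A X \<longleftrightarrow>
     (\<forall>i j. i \<notin> V \<or> j \<notin> V \<longrightarrow> X i j = 0) \<and>
     (\<forall>i\<in>V. \<forall>j\<in>V. mat_mult_on V (mat_mult_on V A X) A i j = A i j) \<and>
     (\<forall>i\<in>V. \<forall>j\<in>V. mat_mult_on V (mat_mult_on V X A) X i j = X i j) \<and>
     (\<forall>i\<in>V. \<forall>j\<in>V. mat_mult_on V A X i j = mat_mult_on V A X j i) \<and>
     (\<forall>i\<in>V. \<forall>j\<in>V. mat_mult_on V X A i j = mat_mult_on V X A j i)"

definition moore_penrose_on :: "'a set \<Rightarrow> ('a \<Rightarrow> 'a \<Rightarrow> real) \<Rightarrow> 'a \<Rightarrow> 'a \<Rightarrow> real" where
  "moore_penrose_on V A = (THE X. is_moore_penrose_on V A X)"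

lemma mat_mult_on_assoc:
  "mat_mult_on V (mat_mult_on V A B) C = mat_mult_on V A (mat_mult_on V B C)"
proof (intro ext)
  fix i j
  have "(\<Sum>k\<in>V. (\<Sum>l\<in>V. A i l * B l k) * C k j) = (\<Sum>k\<in>V. \<Sum>l\<in>V. A i l * (B l k * C k j))"
    by (simp add: sum_distrib_right mult.assoc)
  also have "\<dots> = (\<Sum>l\<in>V. \<Sum>k\<in>V. A i l * (B l k * C k j))"
    by (rule sum.swap)
  also have "\<dots> = (\<Sum>l\<in>V. A i l * (\<Sum>k\<in>V. B l k * C k j))"
    by (simp add: sum_distrib_left)
  finally show "mat_mult_on V (mat_mult_on V A B) C i j = mat_mult_on V A (mat_mult_on V B C) i j"
    by (simp add: mat_mult_on_def)
qed

lemma mat_mult_on_cong: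
  assumes "\<And>i j. i \<in> V \<Longrightarrow> j \<in> V \<Longrightarrow> A i j = A' i j"
    and "\<And>i j. i \<in> V \<Longrightarrow> j \<in> V \<Longrightarrow> B i j = B' i j"
    and "i \<in> V" "j \<in> V"
  shows "mat_mult_on V A B i j = mat_mult_on V A' B' i j"
  using assms by (auto simp: mat_mult_on_def intro!: sum.cong)

text \<open>Uniqueness: \<open>A X = A Y A X = (A Y)\<^sup>T (A X)\<^sup>T = (A X A Y)\<^sup>T = (A Y)\<^sup>T = A Y\<close>, dually
  \<open>X A = Y A\<close>, hence \<open>X = X A X = Y A Y = Y\<close>.\<close>

lemma is_moore_penrose_on_unique:
  assumes X: "is_moore_penrose_on V A X" and Y: "is_moore_penrose_on V A Y"
  shows "X = Y"
proof -
  let ?m = "mat_mult_on V"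
  note a = mat_mult_on_assoc
  have swap: "?m P Q i j = ?m Q P j i"
    if "\<And>i j. i \<in> V \<Longrightarrow> j \<in> V \<Longrightarrow> P i j = P j i" "\<And>i j. i \<in> V \<Longrightarrow> j \<in> V \<Longrightarrow> Q i j = Q j i"
      "i \<in> V" "j \<in> V" for P Q i j
    using that by (auto simp: mat_mult_on_def mult.commute intro!: sum.cong)
  have AXAY: "?m A X i j = ?m A Y i j" if ij: "i \<in> V" "j \<in> V" for i j
  proof -
    have "?m A X i j = ?m (?m (?m A Y) A) X i j"
      by (rule mat_mult_on_cong) (use Y ij in \<open>auto simp: is_moore_penrose_on_def\<close>)
    also have "\<dots> = ?m (?m A Y) (?m A X) i j" by (simp add: a)
    also have "\<dots> = ?m (?m A X) (?m A Y) j i"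
      by (rule swap) (use X Y ij in \<open>auto simp: is_moore_penrose_on_def\<close>)
    also have "\<dots> = ?m (?m (?m A X) A) Y j i" by (simp add: a)
    also have "\<dots> = ?m A Y j i"
      by (rule mat_mult_on_cong) (use X ij in \<open>auto simp: is_moore_penrose_on_def\<close>)
    also have "\<dots> = ?m A Y i j" using Y ij by (auto simp: is_moore_penrose_on_def)
    finally show ?thesis .
  qed
  have XAYA: "?m X A i j = ?m Y A i j" if ij: "i \<in> V" "j \<in> V" for i j
  proof -
    have "?m X A i j = ?m X (?m (?m A Y) A) i j"
      by (rule mat_mult_on_cong) (use Y ij in \<open>auto simp: is_moore_penrose_on_def\<close>)
    also have "\<dots> = ?m (?m X A) (?m Y A) i j" by (simp add: a)
    also have "\<dots> = ?m (?m Y A) (?m X A) j i"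
      by (rule swap) (use X Y ij in \<open>auto simp: is_moore_penrose_on_def\<close>)
    also have "\<dots> = ?m Y (?m (?m A X) A) j i" by (simp add: a)
    also have "\<dots> = ?m Y A j i"
      by (rule mat_mult_on_cong) (use X ij in \<open>auto simp: is_moore_penrose_on_def\<close>)
    also have "\<dots> = ?m Y A i j" using Y ij by (auto simp: is_moore_penrose_on_def)
    finally show ?thesis .
  qed
  show ?thesis
  proof (intro ext)
    fix i j
    show "X i j = Y i j"
    proof (cases "i \<in> V \<and> j \<in> V")
      case True
      then have "X i j = ?m (?m X A) X i j" using X by (auto simp: is_moore_penrose_on_def)
      also have "\<dots> = ?m (?m Y A) X i j"
        by (rule mat_mult_on_cong) (use True XAYA in auto)
      also have "\<dots> = ?m Y (?m A X) i j" by (simp add: a)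
      also have "\<dots> = ?m Y (?m A Y) i j"
        by (rule mat_mult_on_cong) (use True AXAY in auto)
      also have "\<dots> = ?m (?m Y A) Y i j" by (simp add: a)
      also have "\<dots> = Y i j" using True Y by (auto simp: is_moore_penrose_on_def)
      finally show ?thesis .
    qed (use X Y in \<open>auto simp: is_moore_penrose_on_def\<close>)
  qed
qed

lemma moore_penrose_on_eqI: "is_moore_penrose_on V A X \<Longrightarrow> moore_penrose_on V A = X"
  unfolding moore_penrose_on_def by (blast intro: is_moore_penrose_on_unique)

definition laplacian :: "('a,'b) pre_digraph \<Rightarrow> 'a \<Rightarrow> 'a \<Rightarrow> real" where
  "laplacian G u v = (if u = v then real (out_degree G u) else 0) - of_bool (u \<rightarrow>\<^bsub>G\<^esub> v)"

definition unit_vec :: "'a \<Rightarrow> 'a \<Rightarrow> real" where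
  "unit_vec a i = of_bool (i = a)"

definition resistance :: "('a,'b) pre_digraph \<Rightarrow> 'a \<Rightarrow> 'a \<Rightarrow> real" where
  "resistance G a b =
     (\<Sum>i\<in>verts G. \<Sum>j\<in>verts G. (unit_vec a i - unit_vec b i) *
        moore_penrose_on (verts G) (laplacian G) i j * (unit_vec a j - unit_vec b j))"

lemma resistance_sym: "resistance G a b = resistance G b a"
  unfolding resistance_def by (intro sum.cong refl) (simp add: algebra_simps)

text \<open>The sum over unordered pairs of distinct vertices is half the sum over ordered ones, as
  \<open>resistance\<close> is symmetric.\<close>

definition kirchhoff_index :: "('a,'b) pre_digraph \<Rightarrow> real" where
  "kirchhoff_index G = (\<Sum>u\<in>verts G. \<Sum>w\<in>verts G - {u}. resistance G u w) / 2"

text \<open>The qualified name avoids the topological \<open>connected\<close>; the empty graph is not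
  connected in this sense.\<close>

definition good_vertex :: "('a,'b) pre_digraph \<Rightarrow> 'a \<Rightarrow> bool" where
  "good_vertex G v \<longleftrightarrow>
     Digraph_Component.connected G \<and> v \<in> verts G \<and>
     Digraph_Component.connected (pre_digraph.del_vert G v) \<and>
     kirchhoff_index G = kirchhoff_index (pre_digraph.del_vert G v)"

definition good_proportion :: "('a,'b) pre_digraph \<Rightarrow> real" where
  "good_proportion G = real (card {v \<in> verts G. good_vertex G v}) / real (card (verts G))"

definition graph_join ::
    "('a,'b) pre_digraph \<Rightarrow> ('c,'d) pre_digraph \<Rightarrow> ('a + 'c, ('a + 'c) \<times> ('a + 'c)) pre_digraph" where
  "graph_join G H = with_proj
     \<lparr> pverts = Inl ` verts G \<union> Inr ` verts H,
       parcs = {(Inl u, Inl v) | u v. u \<rightarrow>\<^bsub>G\<^esub> v} \<union> {(Inr u, Inr v) | u v. u \<rightarrow>\<^bsub>H\<^esub> v}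
         \<union> (Inl ` verts G) \<times> (Inr ` verts H) \<union> (Inr ` verts H) \<times> (Inl ` verts G) \<rparr>"

text \<open>In the splice of \<open>k\<close> copies of \<open>H\<close> at \<open>x\<close>, \<open>None\<close> is the vertex obtained by identifying
  the copies of \<open>x\<close>, and \<open>Some (i, v)\<close> is the \<open>i\<close>-th copy of a vertex \<open>v \<noteq> x\<close>, where \<open>i < k\<close>.\<close>

definition splice_vertex :: "'a \<Rightarrow> nat \<Rightarrow> 'a \<Rightarrow> (nat \<times> 'a) option" where
  "splice_vertex x i v = (if v = x then None else Some (i, v))"

definition graph_splice ::
    "nat \<Rightarrow> ('a,'b) pre_digraph \<Rightarrow> 'a
      \<Rightarrow> ((nat \<times> 'a) option, (nat \<times> 'a) option \<times> (nat \<times> 'a) option) pre_digraph" where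
  "graph_splice k H x = with_proj
     \<lparr> pverts = {splice_vertex x i v | i v. i < k \<and> v \<in> verts H},
       parcs = {(splice_vertex x i u, splice_vertex x i v) | i u v. i < k \<and> u \<rightarrow>\<^bsub>H\<^esub> v} \<rparr>"

end

theory Submission
  imports Defs
begin

text \<open>
  If \<open>h\<close> is the Green function of a graph on \<open>n\<close> vertices grounded at a vertex \<open>r\<close>, then
  \<open>\<Omega>(a, b) = h a a + h b b - 2 h a b\<close>, hence the Kirchhoff index is \<open>n tr h - \<Sum> h\<close>. Grounding a
  splice at the identified vertex makes \<open>h\<close> block diagonal, so trace and total sum of \<open>h\<close> add up
  over the copies, whether or not a vertex has been deleted from one of them. With \<open>m = s + 1\<close>, a copy
  contributes trace \<open>(7m - 5) / (2m)\<close> and total \<open>4m - 3\<close>. Deleting a vertex of full degree turns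
  the trace into \<open>(7m - 5) / (2m - 1)\<close> and keeps the total, which leaves the Kirchhoff index
  unchanged for every \<open>k\<close>; deleting any other vertex but \<open>x\<close> decreases it. Deleting \<open>x\<close> disconnects
  the splice if \<open>k \<ge> 2\<close>; for \<open>k = 1\<close> another independent vertex can be taken as the ground.
\<close>

section \<open>Resistances from a Green function\<close>

lemma (in nomulti_digraph) out_degree_eq_card_dominates:
  "out_degree G u = card {v. u \<rightarrow>\<^bsub>G\<^esub> v}"
proof -
  have "inj_on (head G) (out_arcs G u)"
    using no_multi_arcs by (auto simp: inj_on_def arc_to_ends_def)
  moreover have "head G ` out_arcs G u = {v. u \<rightarrow>\<^bsub>G\<^esub> v}"
    by (auto simp: arcs_ends_conv)
  ultimately show ?thesis
    by (metis card_image out_degree_def)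
qed

text \<open>The degree on the diagonal is spread over the edges at \<open>u\<close>. Green functions
  are characterised in this edge-difference form, so degrees never have to be computed.\<close>

lemma (in digraph) laplacian_sum:
  assumes "u \<in> verts G"
  shows "(\<Sum>v\<in>verts G. laplacian G u v * f v) = (\<Sum>v | u \<rightarrow>\<^bsub>G\<^esub> v. f u - f v)"
proof -
  have N: "{v. u \<rightarrow>\<^bsub>G\<^esub> v} = verts G \<inter> {v. u \<rightarrow>\<^bsub>G\<^esub> v}"
    using adj_in_verts by auto
  have "(\<Sum>v\<in>verts G. laplacian G u v * f v)
      = (\<Sum>v\<in>verts G. if u = v then real (out_degree G u) * f v else 0)
        - (\<Sum>v\<in>verts G. of_bool (u \<rightarrow>\<^bsub>G\<^esub> v) * f v)"
    unfolding sum_subtractf[symmetric]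
    by (intro sum.cong) (auto simp: laplacian_def algebra_simps)
  also have "(\<Sum>v\<in>verts G. of_bool (u \<rightarrow>\<^bsub>G\<^esub> v) * f v) = (\<Sum>v\<in>{v. u \<rightarrow>\<^bsub>G\<^esub> v}. f v)"
    by (subst N) (simp add: sum.inter_restrict of_bool_def if_distrib[where f = "\<lambda>c. c * _"] cong: if_cong)
  finally show ?thesis
    using assms by (simp add: out_degree_eq_card_dominates sum_subtractf)
qed

text \<open>Centring the rows and columns of the Green function gives the Moore--Penrose inverse.\<close>

lemma moore_penrose_on_green:
  fixes A h :: "'a \<Rightarrow> 'a \<Rightarrow> real"
  assumes fin: "finite V" and r: "r \<in> V"
    and A_sym: "\<And>i j. i \<in> V \<Longrightarrow> j \<in> V \<Longrightarrow> A i j = A j i"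
    and A_sum: "\<And>i. i \<in> V \<Longrightarrow> (\<Sum>j\<in>V. A i j) = 0"
    and h_sym: "\<And>i j. i \<in> V \<Longrightarrow> j \<in> V \<Longrightarrow> h i j = h j i"
    and h: "\<And>a u. a \<in> V \<Longrightarrow> u \<in> V \<Longrightarrow>
              (\<Sum>v\<in>V. A u v * h a v) = of_bool (u = a) - of_bool (u = r)"
  defines "avg \<equiv> \<lambda>u. (\<Sum>b\<in>V. h b u) / card V"
  shows "moore_penrose_on V A = (\<lambda>i j. if i \<in> V \<and> j \<in> V
           then h i j - avg i - avg j + (\<Sum>u\<in>V. avg u) / card V else 0)"
    (is "_ = ?X")
proof (rule moore_penrose_on_eqI)
  let ?n = "real (card V)"
  have n: "?n \<noteq> 0" using fin r by auto
  define M where "M = (\<Sum>u\<in>V. avg u) / ?n"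
  have X: "?X i j = h i j - avg i - avg j + M" if "i \<in> V" "j \<in> V" for i j
    using that by (simp add: M_def)
  have X_sym: "?X i j = ?X j i" if "i \<in> V" "j \<in> V" for i j
    using that h_sym by simp
  have X_sum: "(\<Sum>j\<in>V. ?X i j) = 0" if "i \<in> V" for i
  proof -
    have "(\<Sum>j\<in>V. ?X i j) = (\<Sum>j\<in>V. h i j - avg i - avg j + M)"
      using X that by (intro sum.cong) auto
    also have "\<dots> = (\<Sum>j\<in>V. h i j) - ?n * avg i - (\<Sum>j\<in>V. avg j) + ?n * M"
      by (simp add: sum.distrib sum_subtractf)
    also have "(\<Sum>j\<in>V. h i j) = ?n * avg i"
      using n h_sym that by (simp add: avg_def)
    finally show ?thesis using n by (simp add: M_def)
  qed
  \<comment> \<open>The equation \<open>h\<close> is averaged over all poles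
    \<open>a\<close>.\<close>
  have A_avg: "(\<Sum>k\<in>V. A i k * avg k) = 1 / ?n - of_bool (i = r)" if i: "i \<in> V" for i
  proof -
    have "(\<Sum>k\<in>V. A i k * avg k) = (\<Sum>k\<in>V. \<Sum>b\<in>V. A i k * h b k) / ?n"
      by (simp add: avg_def sum_distrib_left sum_divide_distrib)
    also have "(\<Sum>k\<in>V. \<Sum>b\<in>V. A i k * h b k) = (\<Sum>b\<in>V. \<Sum>k\<in>V. A i k * h b k)"
      by (rule sum.swap)
    also have "\<dots> = (\<Sum>b\<in>V. of_bool (i = b) - of_bool (i = r))"
      using h i by (intro sum.cong) auto
    also have "\<dots> = 1 - ?n * of_bool (i = r)"
      using i fin by (simp add: sum_subtractf of_bool_def)
    finally show ?thesis using n by (simp add: field_simps)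
  qed
  \<comment> \<open>Both products turn out to be the orthogonal projection onto the complement of
    the constants, which is symmetric.\<close>
  have AX: "mat_mult_on V A ?X i j = of_bool (i = j) - 1 / ?n" if i: "i \<in> V" and j: "j \<in> V" for i j
  proof -
    have "mat_mult_on V A ?X i j
        = (\<Sum>k\<in>V. A i k * h j k - A i k * avg k - (avg j - M) * A i k)"
      unfolding mat_mult_on_def using X j h_sym
      by (intro sum.cong) (auto simp: algebra_simps)
    also have "\<dots> = (\<Sum>k\<in>V. A i k * h j k) - (\<Sum>k\<in>V. A i k * avg k) - (avg j - M) * (\<Sum>k\<in>V. A i k)"
      by (simp add: sum_subtractf sum_distrib_left)
    finally show ?thesis using h A_avg A_sum i j by simp
  qed
  have XA: "mat_mult_on V ?X A i j = of_bool (i = j) - 1 / ?n" if i: "i \<in> V" and j: "j \<in> V" for i j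
  proof -
    have "mat_mult_on V ?X A i j = mat_mult_on V A ?X j i"
      unfolding mat_mult_on_def using X_sym A_sym i j
      by (intro sum.cong) (auto simp: mult.commute)
    then show ?thesis using AX i j by auto
  qed
  \<comment> \<open>This projection fixes every column with zero sum. The columns of
    \<open>A\<close> and of the candidate inverse are such, which gives the first two Penrose
    conditions.\<close>
  have proj: "mat_mult_on V P Q i j = Q i j"
    if P: "\<And>i j. i \<in> V \<Longrightarrow> j \<in> V \<Longrightarrow> P i j = of_bool (i = j) - 1 / ?n"
      and Q: "(\<Sum>k\<in>V. Q k j) = 0" and "i \<in> V" "j \<in> V" for P Q :: "'a \<Rightarrow> 'a \<Rightarrow> real" and i j
  proof -
    have "mat_mult_on V P Q i j = (\<Sum>k\<in>V. (if i = k then Q k j else 0) - 1 / ?n * Q k j)"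
      unfolding mat_mult_on_def by (intro sum.cong) (auto simp: P that left_diff_distrib)
    also have "\<dots> = Q i j"
      using that fin by (simp add: sum_subtractf sum_divide_distrib[symmetric] Q)
    finally show ?thesis .
  qed
  show "is_moore_penrose_on V A ?X"
    unfolding is_moore_penrose_on_def
  proof (intro conjI ballI)
    show "\<forall>i j. i \<notin> V \<or> j \<notin> V \<longrightarrow> ?X i j = 0" by auto
    fix i j assume ij: "i \<in> V" "j \<in> V"
    have "(\<Sum>k\<in>V. A k j) = (\<Sum>k\<in>V. A j k)" using A_sym ij by (intro sum.cong) auto
    then show "mat_mult_on V (mat_mult_on V A ?X) A i j = A i j"
      using A_sum ij AX by (intro proj) auto
    have "(\<Sum>k\<in>V. ?X k j) = (\<Sum>k\<in>V. ?X j k)" using X_sym ij by (intro sum.cong) auto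
    then show "mat_mult_on V (mat_mult_on V ?X A) ?X i j = ?X i j"
      using X_sum[of j] ij XA by (intro proj) auto
    show "mat_mult_on V A ?X i j = mat_mult_on V A ?X j i" using AX ij by auto
    show "mat_mult_on V ?X A i j = mat_mult_on V ?X A j i" using XA ij by auto
  qed
qed

context graph
begin

lemma laplacian_sym: "laplacian G u v = laplacian G v u"
  using arcs_ends_symmetric[OF sym_arcs] by (auto simp: laplacian_def)

text \<open>The terms by which the Moore-Penrose inverse differs from \<open>h\<close> depend on
  only one index or on none, so they cancel in the quadratic form at the difference of two unit
  vectors.\<close>

lemma resistance_green:
  fixes h :: "'a \<Rightarrow> 'a \<Rightarrow> real"
  assumes r: "r \<in> verts G"
    and h_sym: "\<And>i j. i \<in> verts G \<Longrightarrow> j \<in> verts G \<Longrightarrow> h i j = h j i"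
    and h: "\<And>a u. a \<in> verts G \<Longrightarrow> u \<in> verts G \<Longrightarrow>
              (\<Sum>v | u \<rightarrow>\<^bsub>G\<^esub> v. h a u - h a v) = of_bool (u = a) - of_bool (u = r)"
    and ab: "a \<in> verts G" "b \<in> verts G"
  shows "resistance G a b = h a a + h b b - 2 * h a b"
proof -
  let ?V = "verts G" and ?X = "moore_penrose_on (verts G) (laplacian G)"
  define avg where "avg u = (\<Sum>b\<in>?V. h b u) / card ?V" for u
  have X: "?X i j = h i j - avg i - avg j + (\<Sum>u\<in>?V. avg u) / card ?V"
    if "i \<in> ?V" "j \<in> ?V" for i j
    unfolding avg_def
    by (subst moore_penrose_on_green[where r = r and h = h])
      (use that r h_sym h laplacian_sum[where f = "\<lambda>_. 1"] laplacian_sym in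
        \<open>auto simp: laplacian_sum\<close>)
  have delta: "(\<Sum>i\<in>?V. (unit_vec a i - unit_vec b i) * f i) = f a - f b" for f :: "'a \<Rightarrow> real"
  proof -
    have "(\<Sum>i\<in>?V. (unit_vec a i - unit_vec b i) * f i)
        = (\<Sum>i\<in>?V. if a = i then f i else 0) - (\<Sum>i\<in>?V. if b = i then f i else 0)"
      unfolding sum_subtractf[symmetric]
      by (intro sum.cong) (auto simp: unit_vec_def)
    then show ?thesis using ab by simp
  qed
  have "resistance G a b = (\<Sum>i\<in>?V. (unit_vec a i - unit_vec b i) *
      (\<Sum>j\<in>?V. (unit_vec a j - unit_vec b j) * ?X i j))"
    by (simp add: resistance_def sum_distrib_left mult_ac)
  also have "\<dots> = ?X a a - ?X a b - (?X b a - ?X b b)"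
    by (simp add: delta)
  finally show ?thesis using X ab h_sym by simp
qed

lemma kirchhoff_index_green:
  fixes h :: "'a \<Rightarrow> 'a \<Rightarrow> real"
  assumes r: "r \<in> verts G"
    and h_sym: "\<And>i j. i \<in> verts G \<Longrightarrow> j \<in> verts G \<Longrightarrow> h i j = h j i"
    and h: "\<And>a u. a \<in> verts G \<Longrightarrow> u \<in> verts G \<Longrightarrow>
              (\<Sum>v | u \<rightarrow>\<^bsub>G\<^esub> v. h a u - h a v) = of_bool (u = a) - of_bool (u = r)"
  shows "kirchhoff_index G = card (verts G) * (\<Sum>a\<in>verts G. h a a) - (\<Sum>a\<in>verts G. \<Sum>b\<in>verts G. h a b)"
proof -
  let ?V = "verts G"
  note res = resistance_green[where r = r and h = h, OF assms]
  \<comment> \<open>The pairs with \<open>u = w\<close> may be added, as the formula gives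
    resistance 0 there.\<close>
  have "(\<Sum>u\<in>?V. \<Sum>w\<in>?V - {u}. resistance G u w) = (\<Sum>u\<in>?V. \<Sum>w\<in>?V. resistance G u w)"
    by (intro sum.cong refl sum.mono_neutral_left) (auto simp: res)
  also have "\<dots> = (\<Sum>u\<in>?V. \<Sum>w\<in>?V. h u u + h w w - 2 * h u w)"
    by (intro sum.cong refl) (auto simp: res)
  also have "\<dots> = 2 * (card ?V * (\<Sum>a\<in>?V. h a a) - (\<Sum>a\<in>?V. \<Sum>b\<in>?V. h a b))"
    by (simp add: sum.distrib sum_subtractf sum_distrib_left algebra_simps)
  finally show ?thesis by (simp add: kirchhoff_index_def)
qed

end

section \<open>Complete split graphs glued at a vertex\<close>

text \<open>
  Every block consists of the vertices with a common value of \<open>blk\<close> together with \<open>r\<close>; in it,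
  the vertices from \<open>D\<close> are adjacent to all others, and those from \<open>C\<close> as well as \<open>r\<close> are
  pairwise non-adjacent.
\<close>

locale split_wedge = graph W
  for W :: "('a,'b) pre_digraph" +
  fixes r :: 'a and blk :: "'a \<Rightarrow> 'i" and D C :: "'a set"
  assumes verts_eq: "verts W = insert r (D \<union> C)"
    and disj: "D \<inter> C = {}" "r \<notin> D" "r \<notin> C"
    and adj: "u \<rightarrow>\<^bsub>W\<^esub> v \<longleftrightarrow> u \<in> verts W \<and> v \<in> verts W \<and> u \<noteq> v \<and> (u \<in> D \<or> v \<in> D)
               \<and> (u = r \<or> v = r \<or> blk u = blk v)"
    and dominated: "u \<in> C \<Longrightarrow> \<exists>d\<in>D. blk d = blk u"
begin

lemma finite_parts [simp, intro]: "finite D" "finite C"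
  using finite_verts verts_eq by auto

definition num_D :: "'i \<Rightarrow> nat" where "num_D j = card {d \<in> D. blk d = j}"
definition num_C :: "'i \<Rightarrow> nat" where "num_C j = card {c \<in> C. blk c = j}"

lemma num_D_pos: "u \<in> D \<union> C \<Longrightarrow> num_D (blk u) > 0"
  using dominated[of u] by (auto simp: num_D_def card_gt_0_iff)

text \<open>By domination, an index without vertices in \<open>D\<close> has an empty block. The
  quotients by \<open>num_D j = 0\<close> are then multiplied by 0 or have numerator 0, so index
  sets larger than the range of \<open>blk\<close> do no harm.\<close>

lemma num_C_eq_0:
  assumes "num_D j = 0"
  shows "num_C j = 0"
proof -
  have "blk c \<noteq> j" if "c \<in> C" for c
    using num_D_pos[of c] assms that by auto
  then show ?thesis by (simp add: num_C_def)
qed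

text \<open>The inverse of the Laplacian with the row and column of \<open>r\<close> deleted; it is block diagonal.\<close>

definition green :: "'a \<Rightarrow> 'a \<Rightarrow> real" where
  "green a u = (if a = r \<or> u = r \<or> blk a \<noteq> blk u then 0
     else if a \<in> D \<and> u \<in> D
       then (if a = u then 1 / (real (num_D (blk a)) + real (num_C (blk a)) + 1) else 0)
         + (real (num_D (blk a)) + real (num_C (blk a)))
           / ((real (num_D (blk a)) + real (num_C (blk a)) + 1) * real (num_D (blk a)))
       else (if a = u then 1 / real (num_D (blk a)) else 0) + 1 / real (num_D (blk a)))"

lemma green_sym: "green a u = green u a"
  by (auto simp: green_def)

lemma green_r [simp]: "green r u = 0" "green a r = 0"
  by (simp_all add: green_def)

lemma green_off_block: "blk a \<noteq> blk u \<Longrightarrow> green a u = 0"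
  by (simp add: green_def)

lemma green_D_D:
  assumes "a \<in> D" "u \<in> D" "blk a = blk u"
  shows "green a u = (if a = u then 1 / (real (num_D (blk a)) + real (num_C (blk a)) + 1) else 0)
    + (real (num_D (blk a)) + real (num_C (blk a)))
      / ((real (num_D (blk a)) + real (num_C (blk a)) + 1) * real (num_D (blk a)))"
proof -
  have "a \<noteq> r" "u \<noteq> r" using assms disj by auto
  then show ?thesis unfolding green_def using assms by simp
qed

lemma green_C:
  assumes "a \<in> D \<union> C" "u \<in> D \<union> C" "blk a = blk u" "a \<in> C \<or> u \<in> C"
  shows "green a u = (if a = u then 1 / real (num_D (blk a)) else 0) + 1 / real (num_D (blk a))"
proof -
  have "a \<noteq> r" "u \<noteq> r" and not_D: "(a \<in> D \<and> u \<in> D) = False" using assms disj by auto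
  then show ?thesis unfolding green_def not_D using assms by simp
qed

text \<open>This is current conservation at \<open>r\<close>: the unit current injected at
  \<open>a\<close> leaves through \<open>r\<close>, which has potential 0 and whose neighbours are
  the vertices of \<open>D\<close>.\<close>

lemma green_sum_D:
  assumes a: "a \<in> D \<union> C"
  shows "(\<Sum>v | v \<in> D \<and> blk v = blk a. green a v) = 1"
proof -
  let ?S = "{v \<in> D. blk v = blk a}"
  let ?p = "real (num_D (blk a))" and ?c = "real (num_C (blk a))"
  have p: "?p > 0" using num_D_pos a by simp
  have card: "real (card ?S) = ?p" by (simp add: num_D_def)
  show ?thesis
  proof (cases "a \<in> D")
    case True
    have "(\<Sum>v\<in>?S. green a v) = (\<Sum>v\<in>?S. (if a = v then 1 / (?p + ?c + 1) else 0)
            + (?p + ?c) / ((?p + ?c + 1) * ?p))"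
      using True by (intro sum.cong refl green_D_D) auto
    also have "\<dots> = 1 / (?p + ?c + 1) + ?p * ((?p + ?c) / ((?p + ?c + 1) * ?p))"
      using True by (simp add: sum.distrib card)
    also have "\<dots> = 1 / (?p + ?c + 1) + (?p + ?c) / (?p + ?c + 1)"
      using p by simp
    also have "\<dots> = 1"
      using p unfolding add_divide_distrib[symmetric] by simp
    finally show ?thesis .
  next
    case False
    have "(\<Sum>v\<in>?S. green a v) = (\<Sum>v\<in>?S. 1 / ?p)"
    proof (intro sum.cong refl)
      fix v assume "v \<in> ?S"
      then have "green a v = (if a = v then 1 / ?p else 0) + 1 / ?p"
        using False a by (intro green_C) auto
      moreover have "a \<noteq> v" using False \<open>v \<in> ?S\<close> by auto
      ultimately show "green a v = 1 / ?p" by simp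
    qed
    also have "\<dots> = 1" using p by (simp add: card)
    finally show ?thesis .
  qed
qed

text \<open>In the block of \<open>a\<close>, every entry in a column from \<open>C\<close> is 1/p
  with p = \<open>num_D (blk a)\<close>, except that the diagonal entry is 2/p.\<close>

lemma green_sum_C:
  assumes a: "a \<in> D \<union> C"
  shows "(\<Sum>v | v \<in> C \<and> blk v = blk a. green a v)
           = (of_bool (a \<in> C) + num_C (blk a)) / num_D (blk a)"
proof -
  let ?S = "{v \<in> C. blk v = blk a}"
  let ?p = "real (num_D (blk a))"
  have "(\<Sum>v\<in>?S. green a v) = (\<Sum>v\<in>?S. (if a = v then 1 / ?p else 0) + 1 / ?p)"
    using a disj by (intro sum.cong refl green_C) auto
  also have "\<dots> = of_bool (a \<in> C) / ?p + card ?S / ?p"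
    by (simp add: sum.distrib)
  finally show ?thesis by (simp add: num_C_def add_divide_distrib)
qed

lemma sum_block:
  assumes S: "finite S"
  shows "(\<Sum>v\<in>S. green a v) = (\<Sum>v | v \<in> S \<and> blk v = blk a. green a v)"
  using S by (intro sum.mono_neutral_right) (auto intro: green_off_block)

text \<open>The equation is checked separately for \<open>u\<close> at the ground, outside the block
  of \<open>a\<close>, in \<open>C\<close> and in \<open>D\<close>; the sums over neighbours reduce
  to the two partial row sums above.\<close>

lemma green_harmonic:
  assumes a: "a \<in> verts W" and u: "u \<in> verts W"
  shows "(\<Sum>v | u \<rightarrow>\<^bsub>W\<^esub> v. green a u - green a v) = of_bool (u = a) - of_bool (u = r)"
proof (cases "a = r")
  case True
  then show ?thesis by simp
next
  case a_r: False
  then have a': "a \<in> D \<union> C" using a verts_eq by auto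
  let ?p = "real (num_D (blk a))" and ?c = "real (num_C (blk a))"
  let ?Dj = "{v \<in> D. blk v = blk a}" and ?Cj = "{v \<in> C. blk v = blk a}"
  have p: "?p > 0" using num_D_pos a' by simp
  consider "u = r" | "u \<noteq> r" "blk u \<noteq> blk a" | "u \<in> C" "blk u = blk a" | "u \<in> D" "blk u = blk a"
    using u verts_eq by auto
  then show ?thesis
  proof cases
    case 1
    have N: "{v. u \<rightarrow>\<^bsub>W\<^esub> v} = D" unfolding adj verts_eq using 1 disj by blast
    have "(\<Sum>v | u \<rightarrow>\<^bsub>W\<^esub> v. green a u - green a v) = - (\<Sum>v\<in>D. green a v)"
      unfolding N using 1 by (simp add: sum_negf)
    then show ?thesis
      using green_sum_D[OF a'] sum_block[of D a] a_r 1 by auto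
  next
    case 2
    \<comment> \<open>The potential vanishes at \<open>u\<close> and at all its neighbours, which
      lie in the block of \<open>u\<close> or equal \<open>r\<close>.\<close>
    have "green a u - green a v = 0" if "u \<rightarrow>\<^bsub>W\<^esub> v" for v
    proof -
      have "v = r \<or> blk v = blk u" using that 2 unfolding adj by auto
      then have "green a v = 0" using 2 by (metis green_off_block green_r(2))
      then show ?thesis using 2 by (simp add: green_off_block)
    qed
    then show ?thesis using 2 by (auto simp: sum.neutral)
  next
    case 3
    then have N: "{v. u \<rightarrow>\<^bsub>W\<^esub> v} = ?Dj" unfolding adj verts_eq using disj by auto
    have "real (card ?Dj) = ?p" by (simp add: num_D_def)
    then have "(\<Sum>v | u \<rightarrow>\<^bsub>W\<^esub> v. green a u - green a v) = ?p * green a u - 1"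
      using green_sum_D[OF a'] by (simp add: N sum_subtractf)
    moreover have "green a u = (if a = u then 1 / ?p else 0) + 1 / ?p"
      using 3 a' by (intro green_C) auto
    then have "?p * green a u = of_bool (a = u) + 1"
      using p by (cases "a = u") simp_all
    moreover have "u \<noteq> r" using 3 disj by auto
    ultimately show ?thesis by auto
  next
    case 4
    then have N: "{v. u \<rightarrow>\<^bsub>W\<^esub> v} = insert r ((?Dj - {u}) \<union> ?Cj)"
      unfolding adj verts_eq using disj by auto
    have u_r: "u \<noteq> r" using 4 disj by auto
    have "(\<Sum>v | u \<rightarrow>\<^bsub>W\<^esub> v. green a u - green a v)
        = green a u + ((\<Sum>v\<in>?Dj - {u}. green a u - green a v) + (\<Sum>v\<in>?Cj. green a u - green a v))"
      unfolding N using disj by (subst sum.insert, force, force, subst sum.union_disjoint) auto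
    \<comment> \<open>The term for \<open>v = u\<close> is 0, so \<open>u\<close> can be put back
      and the sum over the whole \<open>D\<close> part of the block becomes available.\<close>
    also have "(\<Sum>v\<in>?Dj - {u}. green a u - green a v) = (\<Sum>v\<in>?Dj. green a u - green a v)"
      by (intro sum.mono_neutral_left) auto
    also have "\<dots> = ?p * green a u - 1"
      using green_sum_D[OF a'] by (simp add: sum_subtractf num_D_def)
    also have "(\<Sum>v\<in>?Cj. green a u - green a v) = ?c * green a u - (of_bool (a \<in> C) + ?c) / ?p"
      using green_sum_C[OF a'] by (simp add: sum_subtractf num_C_def)
    finally have eq: "(\<Sum>v | u \<rightarrow>\<^bsub>W\<^esub> v. green a u - green a v)
        = (?p + ?c + 1) * green a u - 1 - (of_bool (a \<in> C) + ?c) / ?p"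
      by (simp add: algebra_simps)
    show ?thesis
    proof (cases "a \<in> D")
      case True
      then have "green a u = (if a = u then 1 / (?p + ?c + 1) else 0) + (?p + ?c) / ((?p + ?c + 1) * ?p)"
        using 4 by (intro green_D_D) auto
      moreover have "N * ((if a = u then 1 / N else 0) + q / (N * ?p)) = of_bool (a = u) + q / ?p"
        if "N > 0" for N q using that by (simp add: distrib_left)
      ultimately have "(?p + ?c + 1) * green a u = of_bool (a = u) + (?p + ?c) / ?p"
        using p by simp
      moreover have "a \<notin> C" using True disj by auto
      ultimately show ?thesis using eq p u_r by (auto simp: field_simps)
    next
      case False
      then have "a \<in> C" "a \<noteq> u" using 4 a' by auto
      moreover from this have "green a u = 1 / ?p" using 4 a' green_C[of a u] by simp
      ultimately show ?thesis using eq p u_r by (simp add: field_simps)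
    qed
  qed
qed

section \<open>The Kirchhoff index as a sum over blocks\<close>

lemma sum_by_block:
  assumes "finite J" "blk ` (D \<union> C) \<subseteq> J"
  shows "(\<Sum>a\<in>D. f (blk a)) = (\<Sum>j\<in>J. real (num_D j) * f j)"
    and "(\<Sum>a\<in>C. f (blk a)) = (\<Sum>j\<in>J. real (num_C j) * f j)"
proof -
  have "(\<Sum>a\<in>D. f (blk a)) = (\<Sum>j\<in>J. \<Sum>a | a \<in> D \<and> blk a = j. f (blk a))"
    using assms by (intro sum.group[symmetric]) auto
  also have "\<dots> = (\<Sum>j\<in>J. real (num_D j) * f j)"
    by (intro sum.cong) (auto simp: num_D_def)
  finally show "(\<Sum>a\<in>D. f (blk a)) = (\<Sum>j\<in>J. real (num_D j) * f j)" .
  have "(\<Sum>a\<in>C. f (blk a)) = (\<Sum>j\<in>J. \<Sum>a | a \<in> C \<and> blk a = j. f (blk a))"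
    using assms by (intro sum.group[symmetric]) auto
  also have "\<dots> = (\<Sum>j\<in>J. real (num_C j) * f j)"
    by (intro sum.cong) (auto simp: num_C_def)
  finally show "(\<Sum>a\<in>C. f (blk a)) = (\<Sum>j\<in>J. real (num_C j) * f j)" .
qed

end

text \<open>
  Contributions of a block with \<open>p\<close> vertices in \<open>D\<close> and \<open>c\<close> in \<open>C\<close> to the trace and to the sum of
  all entries of \<open>green\<close>.
\<close>

definition split_trace :: "nat \<Rightarrow> nat \<Rightarrow> real" where
  "split_trace p c = (2 * p + c) / (p + c + 1) + 2 * c / p"

definition split_total :: "nat \<Rightarrow> nat \<Rightarrow> real" where
  "split_total p c = p + 2 * c + c * (c + 1) / p"

context split_wedge
begin

text \<open>Diagonal entries and row sums of \<open>green\<close> depend only on the block of a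
  vertex and on whether it lies in \<open>D\<close> or \<open>C\<close>, so trace and total can be
  collected block by block.\<close>

lemma kirchhoff_index_eq:
  assumes J: "finite J" "blk ` (D \<union> C) \<subseteq> J"
  shows "kirchhoff_index W = card (verts W) * (\<Sum>j\<in>J. split_trace (num_D j) (num_C j))
           - (\<Sum>j\<in>J. split_total (num_D j) (num_C j))"
proof -
  have split: "(\<Sum>a\<in>verts W. f a) = f r + ((\<Sum>a\<in>D. f a) + (\<Sum>a\<in>C. f a))" for f :: "'a \<Rightarrow> real"
    unfolding verts_eq using disj by (subst sum.insert, simp, simp, subst sum.union_disjoint) auto
  let ?p = "\<lambda>j. real (num_D j)" and ?c = "\<lambda>j. real (num_C j)"
  let ?d = "\<lambda>j. (2 * ?p j + ?c j) / ((?p j + ?c j + 1) * ?p j)"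
  have diag_D: "green a a = ?d (blk a)" if "a \<in> D" for a
  proof -
    define N where "N = real (num_D (blk a)) + real (num_C (blk a)) + 1"
    have p: "real (num_D (blk a)) > 0" using that num_D_pos[of a] by simp
    have "green a a = 1 / N + (real (num_D (blk a)) + real (num_C (blk a))) / (N * num_D (blk a))"
      using that by (simp add: green_D_D N_def)
    also have "\<dots> = (2 * num_D (blk a) + num_C (blk a)) / (N * num_D (blk a))"
      using p by (simp add: add_divide_distrib)
    finally show ?thesis by (simp add: N_def)
  qed
  have diag_C: "green a a = 2 / num_D (blk a)" if "a \<in> C" for a
    using that green_C[of a a] by simp
  have "(\<Sum>a\<in>verts W. green a a) = (\<Sum>a\<in>D. ?d (blk a)) + (\<Sum>a\<in>C. 2 / ?p (blk a))"
    by (simp add: split diag_D diag_C)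
  also have "\<dots> = (\<Sum>j\<in>J. ?p j * ?d j + ?c j * (2 / ?p j))"
    unfolding sum.distrib
    using sum_by_block(1)[OF J, of ?d] sum_by_block(2)[OF J, of "\<lambda>j. 2 / ?p j"] by simp
  also have "\<dots> = (\<Sum>j\<in>J. split_trace (num_D j) (num_C j))"
  proof (intro sum.cong refl)
    fix j assume "j \<in> J"
    show "?p j * ?d j + ?c j * (2 / ?p j) = split_trace (num_D j) (num_C j)"
      using num_C_eq_0[of j] by (cases "num_D j = 0") (simp_all add: split_trace_def)
  qed
  finally have trace: "(\<Sum>a\<in>verts W. green a a) = (\<Sum>j\<in>J. split_trace (num_D j) (num_C j))" .
  have row: "(\<Sum>b\<in>verts W. green a b) = 1 + (of_bool (a \<in> C) + num_C (blk a)) / num_D (blk a)"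
    if "a \<in> D \<union> C" for a
    using green_sum_D[OF that] green_sum_C[OF that] sum_block[of D a] sum_block[of C a]
    by (simp add: split)
  have "(\<Sum>a\<in>verts W. \<Sum>b\<in>verts W. green a b)
      = (\<Sum>a\<in>D. \<Sum>b\<in>verts W. green a b) + (\<Sum>a\<in>C. \<Sum>b\<in>verts W. green a b)"
    by (subst split) simp
  also have "\<dots> = (\<Sum>a\<in>D. 1 + ?c (blk a) / ?p (blk a)) + (\<Sum>a\<in>C. 1 + (1 + ?c (blk a)) / ?p (blk a))"
    using disj by (intro arg_cong2[where f = "(+)"] sum.cong) (auto simp: row)
  also have "\<dots> = (\<Sum>j\<in>J. ?p j * (1 + ?c j / ?p j) + ?c j * (1 + (1 + ?c j) / ?p j))"
    unfolding sum.distrib[of "\<lambda>j. ?p j * _ j" _ J]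
    using sum_by_block(1)[OF J, of "\<lambda>j. 1 + ?c j / ?p j"]
      sum_by_block(2)[OF J, of "\<lambda>j. 1 + (1 + ?c j) / ?p j"] by simp
  also have "\<dots> = (\<Sum>j\<in>J. split_total (num_D j) (num_C j))"
  proof (intro sum.cong refl)
    fix j assume "j \<in> J"
    show "real (num_D j) * (1 + real (num_C j) / real (num_D j))
        + real (num_C j) * (1 + (1 + real (num_C j)) / real (num_D j)) = split_total (num_D j) (num_C j)"
      using num_C_eq_0[of j] by (cases "num_D j = 0") (auto simp: split_total_def field_simps)
  qed
  finally have total: "(\<Sum>a\<in>verts W. \<Sum>b\<in>verts W. green a b)
      = (\<Sum>j\<in>J. split_total (num_D j) (num_C j))" .
  have "kirchhoff_index W = card (verts W) * (\<Sum>a\<in>verts W. green a a)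
      - (\<Sum>a\<in>verts W. \<Sum>b\<in>verts W. green a b)"
    using verts_eq green_sym green_harmonic by (intro kirchhoff_index_green[where r = r]) auto
  then show ?thesis by (simp add: trace total)
qed

section \<open>Size, connectivity, vertex deletion and change of ground\<close>

lemma card_verts:
  assumes J: "finite J" "blk ` (D \<union> C) \<subseteq> J"
  shows "real (card (verts W)) = 1 + (\<Sum>j\<in>J. real (num_D j + num_C j))"
proof -
  have "card (verts W) = 1 + (card D + card C)"
    unfolding verts_eq using disj by (subst card_insert_disjoint) (auto simp: card_Un_disjoint)
  moreover have "real (card D) + real (card C) = (\<Sum>j\<in>J. real (num_D j + num_C j))"
    using sum_by_block[OF J, of "\<lambda>_. 1"] by (simp add: sum.distrib)
  ultimately show ?thesis by simp
qed

text \<open>Vertices of \<open>D\<close> are adjacent to \<open>r\<close>, and those of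
  \<open>C\<close> reach \<open>r\<close> through a vertex of \<open>D\<close> in their
  block.\<close>

lemma connected: "Digraph_Component.connected W"
proof -
  have to_r: "u \<rightarrow>\<^sup>*\<^bsub>W\<^esub> r" if u: "u \<in> verts W" for u
  proof -
    have D: "d \<rightarrow>\<^sup>*\<^bsub>W\<^esub> r" if "d \<in> D" for d
    proof -
      have "d \<rightarrow>\<^bsub>W\<^esub> r" unfolding adj verts_eq using that disj by blast
      then show ?thesis by (rule reachable_adjI)
    qed
    consider "u = r" | "u \<in> D" | "u \<in> C" using u unfolding verts_eq by blast
    then show ?thesis
    proof cases
      case 3
      then obtain d where d: "d \<in> D" "blk d = blk u" using dominated by blast
      then have "u \<rightarrow>\<^bsub>W\<^esub> d" unfolding adj verts_eq using 3 disj by auto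
      then show ?thesis using D[OF d(1)] by (rule adj_reachable_trans)
    qed (use D that in auto)
  qed
  have "u \<rightarrow>\<^sup>*\<^bsub>mk_symmetric W\<^esub> v" if "u \<in> verts W" "v \<in> verts W" for u v
    using reachable_trans[OF to_r[OF that(1)] symmetric_reachable[OF sym_arcs to_r[OF that(2)]]]
    by (rule reachable_mk_symmetricI)
  then show ?thesis
    unfolding Digraph_Component.connected_def using verts_eq by (intro strongly_connectedI) auto
qed

text \<open>Edges avoiding \<open>r\<close> stay inside a block, so \<open>blk\<close> is constant
  along walks. Hence \<open>r\<close> is a cut vertex as soon as two blocks are nonempty.\<close>

lemma connected_del_root:
  assumes con: "Digraph_Component.connected (del_vert r)" and uv: "u \<in> D \<union> C" "v \<in> D \<union> C"
  shows "blk u = blk v"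
proof -
  let ?H = "del_vert r"
  have step: "blk a = blk b" if "(a, b) \<in> (arcs_ends ?H)\<^sup>s" for a b
  proof -
    have "a \<rightarrow>\<^bsub>W\<^esub> b \<or> b \<rightarrow>\<^bsub>W\<^esub> a" "a \<noteq> r" "b \<noteq> r"
      using that by (auto simp: symcl_def arcs_ends_conv del_vert_simps)
    then show ?thesis using adj by auto
  qed
  have "(u, v) \<in> rtrancl_on (verts ?H) ((arcs_ends ?H)\<^sup>s)"
    using con uv disj verts_eq unfolding connected_conv by (auto simp: del_vert_simps)
  then show ?thesis
    by (induction rule: rtrancl_on_induct) (use step in auto)
qed

text \<open>Keeping the ground makes the same index formula available after the deletion. Only
  domination can fail: losing the last vertex of \<open>D\<close> in a block would isolate its
  vertices of \<open>C\<close>.\<close>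

lemma split_wedge_del_vert:
  assumes v: "v \<in> D \<union> C" and dom: "\<And>u. u \<in> C - {v} \<Longrightarrow> \<exists>d\<in>D - {v}. blk d = blk u"
  shows "split_wedge (del_vert v) r blk (D - {v}) (C - {v})"
proof -
  have adj': "a \<rightarrow>\<^bsub>del_vert v\<^esub> b \<longleftrightarrow> a \<rightarrow>\<^bsub>W\<^esub> b \<and> a \<noteq> v \<and> b \<noteq> v" for a b
    by (auto simp: arcs_ends_conv del_vert_simps)
  interpret H: wf_digraph "del_vert v" by (rule wf_digraph_del_vert)
  show ?thesis
  proof
    show "symmetric (del_vert v)"
      using arcs_ends_symmetric[OF sym_arcs] adj' by (auto simp: symmetric_def sym_def)
    show "verts (del_vert v) = insert r (D - {v} \<union> (C - {v}))"
      using v disj by (auto simp: del_vert_simps verts_eq)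
    show "a \<rightarrow>\<^bsub>del_vert v\<^esub> b \<longleftrightarrow> a \<in> verts (del_vert v) \<and> b \<in> verts (del_vert v) \<and> a \<noteq> b
        \<and> (a \<in> D - {v} \<or> b \<in> D - {v}) \<and> (a = r \<or> b = r \<or> blk a = blk b)" for a b
      unfolding adj' adj by (auto simp: del_vert_simps)
  qed (use disj no_loops no_multi_arcs dom in \<open>auto simp: del_vert_simps ends_del_vert\<close>)
qed

text \<open>In a single block, \<open>r\<close> is just one more independent vertex, so it can swap
  roles with \<open>y\<close>. The block map becomes constant because \<open>blk r\<close> was
  arbitrary.\<close>

lemma split_wedge_change_root:
  assumes blk: "\<And>u. u \<in> D \<union> C \<Longrightarrow> blk u = j" and y: "y \<in> C"
  shows "split_wedge W y (\<lambda>_. j) D (insert r (C - {y}))"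
proof
  show "verts W = insert y (D \<union> insert r (C - {y}))" using y verts_eq by auto
  show "u \<rightarrow>\<^bsub>W\<^esub> v \<longleftrightarrow> u \<in> verts W \<and> v \<in> verts W \<and> u \<noteq> v \<and> (u \<in> D \<or> v \<in> D)
      \<and> (u = y \<or> v = y \<or> j = j)" for u v
    unfolding adj verts_eq using blk by auto
  show "\<exists>d\<in>D. j = j" using dominated[OF y] by auto
qed (use disj y in auto)

end


text \<open>The pairs of arguments describe an intact block, a block that lost a vertex of
  \<open>D\<close>, and one that lost a vertex of \<open>C\<close>. In the last case the trace is
  multiplied by 2m - 1, the form in which the comparison of indices uses it.\<close>

lemma split_values:
  assumes "m \<ge> 2"
  shows "split_trace m (m - 1) = (7 * real m - 5) / (2 * real m)"
    "split_trace (m - 1) (m - 1) = (7 * real m - 5) / (2 * real m - 1)"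
    "(2 * real m - 1) * split_trace m (m - 2) = 7 * real m - 12 + 4 / real m"
    "split_total m (m - 1) = 4 * real m - 3"
    "split_total (m - 1) (m - 1) = 4 * real m - 3"
    "split_total m (m - 2) = 4 * real m - 7 + 2 / real m"
proof -
  \<comment> \<open>This removes the truncated subtractions.\<close>
  obtain n where n: "m = n + 2" using assms by (metis add.commute le_Suc_ex)
  have [simp]: "2 * real n + 3 \<noteq> 0" "real n + 1 \<noteq> 0" "real n + 2 \<noteq> 0" by linarith+
  show "split_trace m (m - 1) = (7 * real m - 5) / (2 * real m)"
    "split_trace (m - 1) (m - 1) = (7 * real m - 5) / (2 * real m - 1)"
    "(2 * real m - 1) * split_trace m (m - 2) = 7 * real m - 12 + 4 / real m"
    "split_total m (m - 1) = 4 * real m - 3"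
    "split_total (m - 1) (m - 1) = 4 * real m - 3"
    "split_total m (m - 2) = 4 * real m - 7 + 2 / real m"
    unfolding n split_trace_def split_total_def
    by (simp_all add: divide_simps) (simp_all add: algebra_simps)
qed

section \<open>Good vertices\<close>

text \<open>A one-element \<open>J\<close> gives a single graph and \<open>J = {..<k}\<close> its
  splice, so both are treated at once. A block has only m - 1 vertices in \<open>C\<close>, since
  \<open>r\<close> is its m-th independent vertex.\<close>

locale uniform_split_wedge = split_wedge W r blk D C
  for W :: "('a,'b) pre_digraph" and r and blk :: "'a \<Rightarrow> 'i" and D C +
  fixes J :: "'i set" and m :: nat
  assumes m: "m \<ge> 2" and J: "finite J" "J \<noteq> {}" "blk ` (D \<union> C) \<subseteq> J"
    and num_D: "j \<in> J \<Longrightarrow> card {d \<in> D. blk d = j} = m"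
    and num_C: "j \<in> J \<Longrightarrow> card {c \<in> C. blk c = j} = m - 1"
begin

lemma kirchhoff_index_uniform:
  "kirchhoff_index W = (1 + real (card J) * (2 * real m - 1)) * card J * split_trace m (m - 1)
     - card J * split_total m (m - 1)"
  and card_verts_uniform: "real (card (verts W)) = 1 + real (card J) * (2 * real m - 1)"
proof -
  have "(\<Sum>j\<in>J. real (num_D j + num_C j)) = (\<Sum>j\<in>J. 2 * real m - 1)"
    using m by (intro sum.cong) (auto simp: num_D_def num_C_def num_D num_C of_nat_diff)
  then show card: "real (card (verts W)) = 1 + real (card J) * (2 * real m - 1)"
    using card_verts[OF J(1,3)] by simp
  have "(\<Sum>j\<in>J. split_trace (num_D j) (num_C j)) = card J * split_trace m (m - 1)"
    "(\<Sum>j\<in>J. split_total (num_D j) (num_C j)) = card J * split_total m (m - 1)"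
    by (simp_all add: num_D_def num_C_def num_D num_C)
  then show "kirchhoff_index W = (1 + real (card J) * (2 * real m - 1)) * card J * split_trace m (m - 1)
     - card J * split_total m (m - 1)"
    unfolding kirchhoff_index_eq[OF J(1,3)] card by simp
qed

lemma split_wedge_del:
  assumes v: "v \<in> D \<union> C"
  shows "split_wedge (del_vert v) r blk (D - {v}) (C - {v})"
proof (rule split_wedge_del_vert[OF v])
  fix u assume u: "u \<in> C - {v}"
  \<comment> \<open>As m is at least 2, one deletion cannot exhaust the \<open>D\<close> part of a
    block.\<close>
  have "\<not> {d \<in> D. blk d = blk u} \<subseteq> {v}"
  proof
    assume "{d \<in> D. blk d = blk u} \<subseteq> {v}"
    then have "card {d \<in> D. blk d = blk u} \<le> card {v}" by (intro card_mono) auto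
    then show False using num_D[of "blk u"] J(3) u m by auto
  qed
  then show "\<exists>d\<in>D - {v}. blk d = blk u" by auto
qed

text \<open>Only the block of \<open>v\<close> changes; \<open>p\<close> and \<open>c\<close> are
  its new part sizes.\<close>

lemma kirchhoff_index_del_vert:
  assumes v: "v \<in> D \<union> C"
  defines "p \<equiv> if v \<in> D then m - 1 else m" and "c \<equiv> if v \<in> D then m - 1 else m - 2"
  shows "kirchhoff_index (del_vert v)
    = real (card J) * (2 * real m - 1) * ((real (card J) - 1) * split_trace m (m - 1) + split_trace p c)
      - ((real (card J) - 1) * split_total m (m - 1) + split_total p c)"
proof -
  interpret H: split_wedge "del_vert v" r blk "D - {v}" "C - {v}"
    using v by (rule split_wedge_del)
  let ?i = "blk v"
  have i: "?i \<in> J" using v J by auto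
  have HD: "H.num_D j = (if j = ?i then p else m)" if "j \<in> J" for j
  proof -
    have "{d \<in> D - {v}. blk d = j} = {d \<in> D. blk d = j} - {v}" by auto
    then have "H.num_D j = card ({d \<in> D. blk d = j} - {v})" by (simp only: H.num_D_def)
    also have "\<dots> = (if v \<in> D \<and> ?i = j then m - 1 else m)"
      using num_D[OF that] by (simp add: card_Diff_singleton_if)
    finally show ?thesis by (simp add: p_def eq_commute)
  qed
  have HC: "H.num_C j = (if j = ?i then c else m - 1)" if "j \<in> J" for j
  proof -
    have "{d \<in> C - {v}. blk d = j} = {d \<in> C. blk d = j} - {v}" by auto
    then have "H.num_C j = card ({d \<in> C. blk d = j} - {v})" by (simp only: H.num_C_def)
    also have "\<dots> = (if v \<in> C \<and> ?i = j then m - 2 else m - 1)"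
      using num_C[OF that] by (auto simp: card_Diff_singleton_if)
    also have "v \<in> C \<longleftrightarrow> v \<notin> D" using v disj by auto
    finally show ?thesis by (simp add: c_def eq_commute)
  qed
  have sum_J: "(\<Sum>j\<in>J. f (H.num_D j) (H.num_C j)) = (real (card J) - 1) * f m (m - 1) + f p c"
    for f :: "nat \<Rightarrow> nat \<Rightarrow> real"
  proof -
    have "card J \<ge> 1" using J(1,2) by (simp add: Suc_leI card_gt_0_iff)
    then have "(\<Sum>j\<in>J - {?i}. f (H.num_D j) (H.num_C j)) = (real (card J) - 1) * f m (m - 1)"
      using i J(1) by (simp add: HD HC of_nat_diff)
    moreover have "f (H.num_D ?i) (H.num_C ?i) = f p c"
      using i by (simp add: HD HC)
    ultimately show ?thesis using sum.remove[OF J(1) i, of "\<lambda>j. f (H.num_D j) (H.num_C j)"] by linarith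
  qed
  have "v \<in> verts W" using v verts_eq by auto
  from card_Suc_Diff1[OF finite_verts this]
  have "real (card (verts (del_vert v))) = real (card (verts W)) - 1"
    by (simp add: del_vert_simps)
  then have card: "real (card (verts (del_vert v))) = real (card J) * (2 * real m - 1)"
    by (simp add: card_verts_uniform)
  have JH: "blk ` (D - {v} \<union> (C - {v})) \<subseteq> J" using J(3) by auto
  show ?thesis
    unfolding H.kirchhoff_index_eq[OF J(1) JH] sum_J[of split_trace] sum_J[of split_total] card ..
qed

text \<open>Write k for \<open>card J\<close>, and T, T' for the traces of an intact and of the
  damaged block. The totals agree, and the difference of the indices collapses to k (2m T - (2m - 1)
  T'), where both products are 7m - 5.\<close>

lemma good_vertex_D:
  assumes v: "v \<in> D"
  shows "good_vertex W v"
proof -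
  interpret H: split_wedge "del_vert v" r blk "D - {v}" "C - {v}"
    using v by (intro split_wedge_del) simp
  have "(2 * real m - 1) * split_trace (m - 1) (m - 1) = 7 * real m - 5"
    "2 * real m * split_trace m (m - 1) = 7 * real m - 5"
    "split_total (m - 1) (m - 1) = split_total m (m - 1)"
    using m split_values[OF m] by simp_all
  then have "kirchhoff_index W - kirchhoff_index (del_vert v) = 0"
    using v by (simp only: kirchhoff_index_uniform kirchhoff_index_del_vert if_True Un_iff simp_thms) algebra
  then show ?thesis
    using v verts_eq connected H.connected by (simp add: good_vertex_def)
qed

lemma not_good_vertex_C:
  assumes v: "v \<in> C"
  shows "\<not> good_vertex W v"
proof -
  let ?k = "real (card J)" and ?m = "real m"
  have k: "?k \<ge> 1" using J(1,2) by (simp add: Suc_leI card_gt_0_iff)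
  have "v \<notin> D" using v disj by auto
  have "kirchhoff_index W - kirchhoff_index (del_vert v)
      = ?k * (2 * ?m * split_trace m (m - 1) - (2 * ?m - 1) * split_trace m (m - 2))
        - (split_total m (m - 1) - split_total m (m - 2))"
    using v \<open>v \<notin> D\<close>
    by (simp only: kirchhoff_index_uniform kirchhoff_index_del_vert if_False Un_iff simp_thms) algebra
  also have "\<dots> = ?k * (7 - 4 / m) - (4 - 2 / m)"
  proof -
    have "2 * ?m * split_trace m (m - 1) = 7 * ?m - 5" using m by (simp only: split_values) simp
    then show ?thesis by (simp only: split_values[OF m]) simp
  qed
  finally have diff: "kirchhoff_index W - kirchhoff_index (del_vert v) = ?k * (7 - 4 / m) - (4 - 2 / m)" .
  \<comment> \<open>The first term of the difference is at least 5, and less than 4 is subtracted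
    from it.\<close>
  have "4 / ?m \<le> 2" "2 / ?m > 0" using m by (auto simp: field_simps)
  moreover define t where "t = 7 - 4 / ?m"
  ultimately have "t \<ge> 5" "4 - 2 / ?m < 4" by simp_all
  moreover from this(1) have "1 * t \<le> ?k * t" using k by (intro mult_right_mono) auto
  ultimately have "kirchhoff_index W - kirchhoff_index (del_vert v) > 0"
    unfolding diff t_def[symmetric] by linarith
  then show ?thesis by (auto simp: good_vertex_def)
qed

text \<open>With several blocks \<open>r\<close> is a cut vertex. With one block the ground moves to
  some \<open>y\<close> in \<open>C\<close>, and \<open>r\<close> becomes an ordinary vertex of the
  independent part.\<close>

lemma not_good_vertex_root: "\<not> good_vertex W r"
proof (cases "\<exists>j. J = {j}")
  case True
  then obtain j where j: "J = {j}" by blast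
  then have blk: "blk u = j" if "u \<in> D \<union> C" for u using J(3) that by auto
  have "card {c \<in> C. blk c = j} \<noteq> 0" using num_C[of j] m j by simp
  then obtain y where y: "y \<in> C" by (metis (no_types, lifting) card.empty empty_Collect_eq)
  interpret H: split_wedge W y "\<lambda>_. j" D "insert r (C - {y})"
    using blk y by (rule split_wedge_change_root)
  have "{d \<in> D. blk d = j} = D" "{c \<in> C. blk c = j} = C" using blk by auto
  then have "card D = m" "card C = m - 1" using num_D[of j] num_C[of j] j by simp_all
  moreover have "card (insert r (C - {y})) = Suc (card (C - {y}))"
    using disj by (intro card_insert_disjoint) auto
  then have "card (insert r (C - {y})) = card C"
    using card_Suc_Diff1[OF finite_parts(2) y] by simp
  ultimately have card: "card D = m" "card (insert r (C - {y})) = m - 1" by simp_all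
  interpret H: uniform_split_wedge W y "\<lambda>_. j" D "insert r (C - {y})" "{j}" m
  proof
    fix j' assume "j' \<in> {j}"
    then have "{d \<in> D. j = j'} = D" "{c \<in> insert r (C - {y}). j = j'} = insert r (C - {y})" by auto
    then show "card {d \<in> D. j = j'} = m" "card {c \<in> insert r (C - {y}). j = j'} = m - 1"
      by (simp_all only: card)
  qed (use m in auto)
  show ?thesis by (rule H.not_good_vertex_C) simp
next
  case False
  then obtain i j where ij: "i \<in> J" "j \<in> J" "i \<noteq> j" using J(2) by blast
  have "\<exists>u\<in>D. blk u = i" if "i \<in> J" for i
    using num_D[OF that] m by (metis (mono_tags, lifting) card.empty empty_Collect_eq not_numeral_le_zero)
  then obtain u v where "u \<in> D" "blk u = i" "v \<in> D" "blk v = j" using ij by metis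
  then show ?thesis using connected_del_root[of u v] ij(3) unfolding good_vertex_def by blast
qed

text \<open>The criterion does not involve \<open>J\<close>, which is why goodness passes from one
  copy to the splice.\<close>

lemma good_vertex_iff: "good_vertex W v \<longleftrightarrow> v \<in> D"
  using good_vertex_D not_good_vertex_C not_good_vertex_root verts_eq
  by (metis UnE good_vertex_def insertE)

lemma good_proportion_uniform:
  "good_proportion W = (real (card J) * real m) / (1 + real (card J) * (2 * real m - 1))"
proof -
  have "{v \<in> verts W. good_vertex W v} = D"
    using verts_eq by (auto simp: good_vertex_iff)
  moreover have "real (card D) = real (card J) * m"
    using sum_by_block(1)[OF J(1,3), of "\<lambda>_. 1"] by (simp add: num_D_def num_D)
  ultimately show ?thesis by (simp add: good_proportion_def card_verts_uniform)
qed

end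

section \<open>Joins and splices as split wedges\<close>

lemma split_wedge_with_projI:
  assumes "finite V" "V = insert r (D \<union> C)" "D \<inter> C = {}" "r \<notin> D" "r \<notin> C"
    and "\<And>u. u \<in> C \<Longrightarrow> \<exists>d\<in>D. blk d = blk u"
    and E: "\<And>u v. (u, v) \<in> E \<longleftrightarrow> u \<in> V \<and> v \<in> V \<and> u \<noteq> v \<and> (u \<in> D \<or> v \<in> D)
               \<and> (u = r \<or> v = r \<or> blk u = blk v)"
  shows "split_wedge (with_proj \<lparr>pverts = V, parcs = E\<rparr>) r blk D C"
proof -
  have "E \<subseteq> V \<times> V" using E by auto
  then have "finite E" using assms(1) finite_subset by blast
  have "sym E" using E by (auto simp: sym_def)
  show ?thesis
    by unfold_locales
      (use assms \<open>finite E\<close> \<open>sym E\<close> in \<open>auto simp: arc_to_ends_def symmetric_def\<close>)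
qed

text \<open>The identified vertex \<open>None\<close> is the ground and the copy number is the
  block. The unspecified value of \<open>fst (the None)\<close> is harmless, as the ground belongs
  to no block.\<close>

lemma uniform_split_wedge_graph_splice:
  assumes G: "uniform_split_wedge G x (\<lambda>_. ()) D C {()} m" and k: "k \<ge> 1"
  shows "uniform_split_wedge (graph_splice k G x) None (\<lambda>v. fst (the v))
    (Some ` ({..<k} \<times> D)) (Some ` ({..<k} \<times> C)) {..<k} m"
proof -
  interpret G: uniform_split_wedge G x "\<lambda>_. ()" D C "{()}" m by (fact G)
  let ?D = "Some ` ({..<k} \<times> D)" and ?C = "Some ` ({..<k} \<times> C)"
  let ?V = "{splice_vertex x i v | i v. i < k \<and> v \<in> verts G}"
  let ?E = "{(splice_vertex x i u, splice_vertex x i v) | i u v. i < k \<and> u \<rightarrow>\<^bsub>G\<^esub> v}"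
  have mem: "Some (j, b) \<in> Some ` ({..<k} \<times> A) \<longleftrightarrow> j < k \<and> b \<in> A" "None \<notin> Some ` ({..<k} \<times> A)"
    for j b and A :: "'a set"
    by auto
  have splice_None: "None = splice_vertex x i a \<longleftrightarrow> a = x"
    and splice_Some: "Some (j, b) = splice_vertex x i a \<longleftrightarrow> a \<noteq> x \<and> j = i \<and> b = a" for i j a b
    by (auto simp: splice_vertex_def)
  have V: "?V = insert None (?D \<union> ?C)"
    using k G.disj unfolding G.verts_eq splice_vertex_def by (force simp: image_iff)
  have E: "(u, v) \<in> ?E \<longleftrightarrow> u \<in> ?V \<and> v \<in> ?V \<and> u \<noteq> v \<and> (u \<in> ?D \<or> v \<in> ?D)
      \<and> (u = None \<or> v = None \<or> fst (the u) = fst (the v))" for u v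
  proof -
    have "(u, v) \<in> ?E \<longleftrightarrow> (\<exists>i a b. i < k \<and> a \<rightarrow>\<^bsub>G\<^esub> b \<and> u = splice_vertex x i a \<and> v = splice_vertex x i b)"
      by blast
    also have "\<dots> \<longleftrightarrow> u \<in> insert None (?D \<union> ?C) \<and> v \<in> insert None (?D \<union> ?C) \<and> u \<noteq> v
        \<and> (u \<in> ?D \<or> v \<in> ?D) \<and> (u = None \<or> v = None \<or> fst (the u) = fst (the v))"
    proof (cases u)
      case None
      then show ?thesis
      proof (cases v)
        case None
        then show ?thesis
          using \<open>u = None\<close> G.disj unfolding G.adj G.verts_eq by (simp add: splice_None mem)
      next
        case (Some q)
        then obtain j b where "v = Some (j, b)" by (cases q) auto
        then show ?thesis
          using \<open>u = None\<close> G.disj unfolding G.adj G.verts_eq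
          by (simp add: splice_None splice_Some mem) blast
      qed
    next
      case (Some q)
      then obtain i a where u: "u = Some (i, a)" by (cases q) auto
      show ?thesis
      proof (cases v)
        case None
        then show ?thesis
          using u G.disj unfolding G.adj G.verts_eq
          by (simp add: splice_None splice_Some mem) blast
      next
        case (Some q)
        then obtain j b where "v = Some (j, b)" by (cases q) auto
        then show ?thesis
          using u G.disj unfolding G.adj G.verts_eq
          by (simp add: splice_None splice_Some mem) blast
      qed
    qed
    finally show ?thesis unfolding V .
  qed
  \<comment> \<open>This provides a dominating vertex in every copy.\<close>
  have "D \<noteq> {}" using G.num_D[of "()"] G.m by auto
  then have "split_wedge (graph_splice k G x) None (\<lambda>v. fst (the v)) ?D ?C"
    unfolding graph_splice_def using G.disj
    by (intro split_wedge_with_projI E V) (auto simp: V)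
  then interpret S: split_wedge "graph_splice k G x" None "\<lambda>v. fst (the v)" ?D ?C .
  have block: "card {d \<in> Some ` ({..<k} \<times> A). fst (the d) = j} = card A" if "j < k" for j and A :: "'a set"
  proof -
    have "{d \<in> Some ` ({..<k} \<times> A). fst (the d) = j} = (\<lambda>a. Some (j, a)) ` A" using that by auto
    then show ?thesis by (simp add: card_image inj_on_def)
  qed
  show ?thesis
  proof
    show "card {d \<in> ?D. fst (the d) = j} = m" "card {c \<in> ?C. fst (the c) = j} = m - 1"
      if "j \<in> {..<k}" for j
      using that block[of j D] block[of j C] G.num_D[of "()"] G.num_C[of "()"] by simp_all
    show "{..<k} \<noteq> {}" using k by (auto simp: set_eq_iff intro: exI[of _ 0])
  qed (use G.m in auto)
qed

theorem theorem15:
  fixes s k :: nat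
    and K :: "('a,'b) pre_digraph" and B :: "('c,'d) pre_digraph"
    and G :: "('a + 'c, ('a + 'c) \<times> ('a + 'c)) pre_digraph"
    and x :: "'a + 'c"
  assumes "s \<ge> 1" and "k \<ge> 1"
    and "complete_digraph s K" and "complete_bipartite_digraph (s + 1) 1 B"
    and "G = graph_join K B"
    and "x \<in> verts G" and "real (out_degree G x) = real (card (verts G)) / 2"
  shows "(\<forall>v. good_vertex G v \<longrightarrow>
             (\<forall>i<k. good_vertex (graph_splice k G x) (splice_vertex x i v)))
         \<and> good_proportion (graph_splice k G x)
             = (real k * (real s + 1)) / (real k * (2 * real s + 1) + 1)"
proof -
  obtain U T where UT: "verts B = U \<union> T" "U \<inter> T = {}" "card U = s + 1" "card T = 1"
    "arcs_ends B = U \<times> T \<union> T \<times> U"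
    using assms(4) unfolding complete_bipartite_digraph_def by blast
  obtain t where t: "T = {t}" using UT(4) card_1_singletonE by blast
  interpret K: graph K using assms(3) by (simp add: complete_digraph_def)
  have K: "card (verts K) = s" "arcs_ends K = {(u,v). (u,v) \<in> verts K \<times> verts K \<and> u \<noteq> v}"
    using assms(3) by (simp_all add: complete_digraph_def)
  have fin_U: "finite U" using UT(3) card.infinite by fastforce
  \<comment> \<open>\<open>D\<close> collects the vertices of full degree: the complete graph and
    the one-vertex side of the bipartite graph. The other side is the independent set
    \<open>I\<close>.\<close>
  define D where "D = insert (Inr t) (Inl ` verts K :: ('a + 'c) set)"
  define I where "I = (Inr ` U :: ('a + 'c) set)"
  have fin: "finite D" "finite I" by (simp_all add: D_def I_def fin_U)
  have card_DI: "card D = s + 1" "card I = s + 1"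
    using K(1) UT(3) by (simp_all add: D_def I_def card_image inj_on_def image_iff)
  have disj: "D \<inter> I = {}" using UT(2) t by (auto simp: D_def I_def)
  have join: "verts G = D \<union> I" "u \<rightarrow>\<^bsub>G\<^esub> v \<longleftrightarrow> u \<in> D \<union> I \<and> v \<in> D \<union> I \<and> u \<noteq> v \<and> (u \<in> D \<or> v \<in> D)" for u v
    using UT(2) unfolding assms(5) graph_join_def D_def I_def
    by (auto simp: K(2) UT(1,5) t)
  have wedge: "split_wedge G y (\<lambda>_. ()) D (I - {y})" if y: "y \<in> I" for y
  proof -
    have "G = with_proj \<lparr>pverts = verts G, parcs = arcs_ends G\<rparr>"
      unfolding assms(5) graph_join_def by (simp add: with_proj_def arcs_ends_conv)
    moreover have "split_wedge (with_proj \<lparr>pverts = verts G, parcs = arcs_ends G\<rparr>) y (\<lambda>_. ()) D (I - {y})"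
      using y fin disj by (intro split_wedge_with_projI) (auto simp: join D_def)
    ultimately show ?thesis by simp
  qed
  have "x \<in> I"
  proof (rule ccontr)
    assume "x \<notin> I"
    then have "x \<in> D" using assms(6) join(1) by auto
    \<comment> \<open>Some ground is needed to have the graph facts for \<open>G\<close>. A vertex
      of \<open>D\<close> has degree 2s + 1, which differs from s + 1 since s is at least 1.\<close>
    obtain y where "y \<in> I" using card_DI(2) by fastforce
    interpret G: split_wedge G y "\<lambda>_. ()" D "I - {y}" using \<open>y \<in> I\<close> by (rule wedge)
    have "{v. x \<rightarrow>\<^bsub>G\<^esub> v} = verts G - {x}" using join \<open>x \<in> D\<close> by auto
    then have "out_degree G x = card (verts G) - 1"
      using assms(6) by (simp add: G.out_degree_eq_card_dominates)
    moreover have "card (verts G) = 2 * s + 2"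
      unfolding join(1) using fin disj by (simp add: card_Un_disjoint card_DI)
    ultimately show False using assms(1,7) by simp
  qed
  then interpret G: split_wedge G x "\<lambda>_. ()" D "I - {x}" by (rule wedge)
  interpret G: uniform_split_wedge G x "\<lambda>_. ()" D "I - {x}" "{()}" "s + 1"
  proof
    have "{d \<in> D. () = j} = D" "{c \<in> I - {x}. () = j} = I - {x}" for j by auto
    moreover have "card (I - {x}) = s" using \<open>x \<in> I\<close> fin(2) card_DI(2) by simp
    ultimately show "card {d \<in> D. () = j} = s + 1" "card {c \<in> I - {x}. () = j} = s + 1 - 1" for j
      by (simp_all add: card_DI(1))
  qed (use assms(1) in auto)
  interpret S: uniform_split_wedge "graph_splice k G x" None "\<lambda>v. fst (the v)"
    "Some ` ({..<k} \<times> D)" "Some ` ({..<k} \<times> (I - {x}))" "{..<k}" "s + 1"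
    using G.uniform_split_wedge_axioms assms(2) by (rule uniform_split_wedge_graph_splice)
  \<comment> \<open>A good vertex lies in \<open>D\<close>, so it is not \<open>x\<close> and its
    copies have the form \<open>Some (i, v)\<close>.\<close>
  have "good_vertex (graph_splice k G x) (splice_vertex x i v)" if "good_vertex G v" "i < k" for v i
    using that G.disj unfolding G.good_vertex_iff S.good_vertex_iff splice_vertex_def by auto
  moreover have "good_proportion (graph_splice k G x) = (real k * (real s + 1)) / (real k * (2 * real s + 1) + 1)"
    unfolding S.good_proportion_uniform by (simp add: algebra_simps)
  ultimately show ?thesis by blast
qed

end
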